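(* Let $\Bbbk$ be a commutative ring and fix $\delta\in\Bbbk$. Then either of the sets $\{\tilde d\mid d\in\mathcal D(k)\}$, $\{\bar d\mid d\in\mathcal D(k)\}$ is a $\Bbbk$-basis of the partial Temperley--Lieb algebra $\mathsf{PTL}_k(\delta)$.
   Context: Rings are unital. Let $[k]=\{1,\dots,k\}$, $[k]'=\{1',\dots,k'\}$. A partial Brauer $k$-diagram is a set partition of $[k]\sqcup[k]'$ into blocks of size at most $2$, drawn with top row of vertices $1,\dots,k$ and bottom row $1',\dots,k'$; blocks of size $2$ are edges, singletons are isolated vertices. An edge is a cup if both endpoints are in $[k]$, a cap if both are in $[k]'$; cups and caps are horizontal, other edges are vertical. A Motzkin $k$-diagram is a partial Brauer $k$-diagram that can be drawn in the rectangle bounded by the two rows without crossings. Product: place $d_1$ above $d_2$, identify vertex $i'$ of $d_1$ with vertex $i$ of $d_2$ (middle row), and let $d_1\circ d_2$ be the diagram on the outer two rows recording connectivity. The Motzkin algebra $\mathsf M_k(\delta)=\mathsf M_k(\delta,1)$ is the unital associative $\Bbbk$-algebra, free on the Motzkin $k$-diagrams, with $d_1d_2=\delta^{N_1}\,d_1\circ d_2$, where $N_1$ is the number of closed loops lying in the middle row (interior paths and isolated middle vertices are discarded with factor $1$). $p_j$ is the diagram with $j,j'$ isolated and vertical edges $\{i,i'\}$ for $i\neq j$. For a Motzkin diagram $d$, let $\lceil d\rceil_H$ (resp. $\lfloor d\rfloor_H$) be the set of $i\in[k]$ such that $i$ (resp. $i'$) is an endpoint of a horizontal edge of $d$, and put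 $$\tilde d=\prod_{i\in\lceil d\rceil_H}(1-p_i)\;d\prod_{i\in\lfloor d\rfloor_H}(1-p_i),\qquad \bar d=\sum_{d'\le d}(-1)^{\beta(d)-\beta(d')}d',$$ where $\beta$ is the number of blocks and $d'\le d$ means $d'$ is obtained from $d$ by removing zero or more edges. A Motzkin diagram is balanced if it has the same number of cups as caps. $\mathcal D(k)$ is the set of balanced Motzkin $k$-diagrams. $\mathsf{PTL}_k(\delta)$ is the $\Bbbk$-linear span of $\{\tilde d\mid d\in\mathcal D(k)\}$ in $\mathsf M_k(\delta)$; it is a subalgebra. *)

theory Defs
  imports "HOL-Analysis.Analysis" "HOL-Library.Poly_Mapping" "HOL-Library.Disjoint_Sets"
begin

section \<open>Diagrams\<close>

text \<open>\<open>Top i\<close> is the vertex \<open>i\<close> of the top row, \<open>Bot i\<close> the vertex \<open>i'\<close> of the bottom row.\<close>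

datatype vertex = Top nat | Bot nat

type_synonym diagram = "vertex set set"

definition vertices :: "nat \<Rightarrow> vertex set" where
  "vertices k = Top ` {1..k} \<union> Bot ` {1..k}"

definition partial_brauer :: "nat \<Rightarrow> diagram set" where
  "partial_brauer k = {d. partition_on (vertices k) d \<and> (\<forall>b\<in>d. card b \<le> 2)}"

definition edges :: "diagram \<Rightarrow> vertex set set" where
  "edges d = {b \<in> d. card b = 2}"

definition cups :: "diagram \<Rightarrow> vertex set set" where
  "cups d = {e \<in> edges d. e \<subseteq> range Top}"

definition caps :: "diagram \<Rightarrow> vertex set set" where
  "caps d = {e \<in> edges d. e \<subseteq> range Bot}"

primrec position :: "vertex \<Rightarrow> real \<times> real" where
  "position (Top i) = (real i, 1)"
| "position (Bot i) = (real i, 0)"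

text \<open>A drawing without crossings: pairwise disjoint simple arcs in the rectangle spanned by the
  two rows, each joining the endpoints of its edge and meeting no further vertex.\<close>

definition planar :: "nat \<Rightarrow> diagram \<Rightarrow> bool" where
  "planar k d \<longleftrightarrow> (\<exists>\<gamma> :: vertex set \<Rightarrow> real \<Rightarrow> real \<times> real.
     (\<forall>e\<in>edges d. arc (\<gamma> e)
        \<and> {pathstart (\<gamma> e), pathfinish (\<gamma> e)} = position ` e
        \<and> path_image (\<gamma> e) \<subseteq> {1..real k} \<times> {0..1}
        \<and> path_image (\<gamma> e) \<inter> position ` vertices k = position ` e)
     \<and> (\<forall>e\<in>edges d. \<forall>e'\<in>edges d. e \<noteq> e' \<longrightarrow> path_image (\<gamma> e) \<inter> path_image (\<gamma> e') = {}))"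

definition motzkin :: "nat \<Rightarrow> diagram set" where
  "motzkin k = {d \<in> partial_brauer k. planar k d}"

definition balanced_motzkin :: "nat \<Rightarrow> diagram set" where
  "balanced_motzkin k = {d \<in> motzkin k. card (cups d) = card (caps d)}"


section \<open>Composition of diagrams\<close>

text \<open>Vertices of the three-row picture in which \<open>d\<^sub>1\<close> is placed above \<open>d\<^sub>2\<close>.\<close>

datatype stack_vertex = Upper nat | Middle nat | Lower nat

primrec above :: "vertex \<Rightarrow> stack_vertex" where
  "above (Top i) = Upper i"
| "above (Bot i) = Middle i"

primrec below :: "vertex \<Rightarrow> stack_vertex" where
  "below (Top i) = Middle i"
| "below (Bot i) = Lower i"

primrec outer :: "vertex \<Rightarrow> stack_vertex" where
  "outer (Top i) = Upper i"
| "outer (Bot i) = Lower i"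

definition connected_in_stack :: "diagram \<Rightarrow> diagram \<Rightarrow> (stack_vertex \<times> stack_vertex) set" where
  "connected_in_stack d\<^sub>1 d\<^sub>2 =
     {(x, y). \<exists>e \<in> (`) above ` edges d\<^sub>1 \<union> (`) below ` edges d\<^sub>2. x \<in> e \<and> y \<in> e}\<^sup>*"

definition diagram_comp :: "nat \<Rightarrow> diagram \<Rightarrow> diagram \<Rightarrow> diagram" where
  "diagram_comp k d\<^sub>1 d\<^sub>2 =
     (\<lambda>u. {v \<in> vertices k. (outer u, outer v) \<in> connected_in_stack d\<^sub>1 d\<^sub>2}) ` vertices k"

text \<open>A connected component of the picture is a path or a closed loop, because every vertex lies on
  at most one edge of each diagram. It is a closed loop in the middle row iff all its
  vertices are middle vertices having both an edge of \<open>d\<^sub>1\<close> and an edge of \<open>d\<^sub>2\<close>; these two edges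
  may connect the same pair of vertices.\<close>

definition middle_loops :: "nat \<Rightarrow> diagram \<Rightarrow> diagram \<Rightarrow> stack_vertex set set" where
  "middle_loops k d\<^sub>1 d\<^sub>2 =
     {C \<in> Middle ` {1..k} // connected_in_stack d\<^sub>1 d\<^sub>2.
        \<forall>v\<in>C. v \<in> range Middle \<and> v \<in> \<Union> ((`) above ` edges d\<^sub>1) \<and> v \<in> \<Union> ((`) below ` edges d\<^sub>2)}"


section \<open>The Motzkin algebra\<close>

text \<open>Elements of the Motzkin algebra are finitely supported functions from diagrams to the ground
  ring, the diagram \<open>d\<close> being \<open>diag d\<close>. The ambient module is free on all sets of sets of vertices; the
  Motzkin algebra of a given \<open>k\<close> is the submodule of functions supported on \<open>motzkin k\<close>, with
  the product \<open>mult k \<delta>\<close> and the unit \<open>diag (id_diagram k)\<close>.\<close>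

abbreviation diag :: "diagram \<Rightarrow> diagram \<Rightarrow>\<^sub>0 'a::comm_ring_1" where
  "diag d \<equiv> Poly_Mapping.single d 1"

definition scale :: "'a::comm_ring_1 \<Rightarrow> ('b \<Rightarrow>\<^sub>0 'a) \<Rightarrow> ('b \<Rightarrow>\<^sub>0 'a)" where
  "scale c x = Poly_Mapping.map ((*) c) x"

lemma lookup_scale [simp]: "Poly_Mapping.lookup (scale c x) d = c * Poly_Mapping.lookup x d"
  by (simp add: scale_def Poly_Mapping.map.rep_eq when_def)

interpretation poly_mapping_module: module scale
  by unfold_locales (auto intro!: poly_mapping_eqI simp: lookup_add algebra_simps)

text \<open>The bilinear extension of \<open>d\<^sub>1 d\<^sub>2 = \<delta>\<^bsup>N\<^esup> (d\<^sub>1 \<circ> d\<^sub>2)\<close>, where \<open>N\<close> is the number of closed loops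
  in the middle row.\<close>

definition mult :: "nat \<Rightarrow> 'a::comm_ring_1 \<Rightarrow>
    (diagram \<Rightarrow>\<^sub>0 'a) \<Rightarrow> (diagram \<Rightarrow>\<^sub>0 'a) \<Rightarrow> (diagram \<Rightarrow>\<^sub>0 'a)" where
  "mult k \<delta> x y =
     (\<Sum>d\<^sub>1\<in>Poly_Mapping.keys x. \<Sum>d\<^sub>2\<in>Poly_Mapping.keys y.
        scale (Poly_Mapping.lookup x d\<^sub>1 * Poly_Mapping.lookup y d\<^sub>2 * \<delta> ^ card (middle_loops k d\<^sub>1 d\<^sub>2))
          (diag (diagram_comp k d\<^sub>1 d\<^sub>2)))"

definition id_diagram :: "nat \<Rightarrow> diagram" where
  "id_diagram k = (\<lambda>i. {Top i, Bot i}) ` {1..k}"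

definition p_diagram :: "nat \<Rightarrow> nat \<Rightarrow> diagram" where
  "p_diagram k j = {{Top j}, {Bot j}} \<union> (\<lambda>i. {Top i, Bot i}) ` ({1..k} - {j})"

text \<open>The product of the elements \<open>1 - p\<^sub>i\<close> for \<open>i\<close> in a finite set \<open>I\<close>. These elements commute; the
  increasing order of the factors is an arbitrary choice.\<close>

definition prod_one_minus_p :: "nat \<Rightarrow> 'a::comm_ring_1 \<Rightarrow> nat set \<Rightarrow> (diagram \<Rightarrow>\<^sub>0 'a)" where
  "prod_one_minus_p k \<delta> I =
     foldr (\<lambda>i. mult k \<delta> (diag (id_diagram k) - diag (p_diagram k i)))
       (sorted_list_of_set I) (diag (id_diagram k))"


section \<open>The two families and the partial Temperley--Lieb algebra\<close>

definition upper_horizontal :: "nat \<Rightarrow> diagram \<Rightarrow> nat set" where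
  "upper_horizontal k d = {i \<in> {1..k}. \<exists>e\<in>cups d. Top i \<in> e}"

definition lower_horizontal :: "nat \<Rightarrow> diagram \<Rightarrow> nat set" where
  "lower_horizontal k d = {i \<in> {1..k}. \<exists>e\<in>caps d. Bot i \<in> e}"

definition tilde :: "nat \<Rightarrow> 'a::comm_ring_1 \<Rightarrow> diagram \<Rightarrow> (diagram \<Rightarrow>\<^sub>0 'a)" where
  "tilde k \<delta> d =
     mult k \<delta> (mult k \<delta> (prod_one_minus_p k \<delta> (upper_horizontal k d)) (diag d))
       (prod_one_minus_p k \<delta> (lower_horizontal k d))"

definition remove_edges :: "diagram \<Rightarrow> vertex set set \<Rightarrow> diagram" where
  "remove_edges d E = (d - E) \<union> (\<lambda>v. {v}) ` \<Union> E"

definition below_diagrams :: "diagram \<Rightarrow> diagram set" where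
  "below_diagrams d = {remove_edges d E | E. E \<subseteq> edges d}"

text \<open>Since \<open>d'\<close> has at least as many blocks as \<open>d\<close>, the exponent is written as an absolute value;
  this does not affect the sign.\<close>

definition bar :: "diagram \<Rightarrow> (diagram \<Rightarrow>\<^sub>0 'a::comm_ring_1)" where
  "bar d = (\<Sum>d'\<in>below_diagrams d.
     scale ((- 1) ^ nat \<bar>int (card d) - int (card d')\<bar>) (diag d'))"

definition PTL :: "nat \<Rightarrow> 'a::comm_ring_1 \<Rightarrow> (diagram \<Rightarrow>\<^sub>0 'a) set" where
  "PTL k \<delta> = module.span scale (tilde k \<delta> ` balanced_motzkin k)"

text \<open>The family \<open>(v i)\<close>, \<open>i \<in> I\<close>, is a basis of the submodule \<open>W\<close>; its members are
  required to be pairwise distinct.\<close>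

definition is_basis :: "('i \<Rightarrow> ('b \<Rightarrow>\<^sub>0 'a::comm_ring_1)) \<Rightarrow> 'i set \<Rightarrow> ('b \<Rightarrow>\<^sub>0 'a) set \<Rightarrow> bool" where
  "is_basis v I W \<longleftrightarrow>
     inj_on v I \<and> \<not> module.dependent scale (v ` I) \<and> module.span scale (v ` I) = W"

end

theory Submission
  imports Defs
begin

text \<open>Multiplying a diagram by a product of \<open>p\<^sub>i\<close>'s removes the edges at the corresponding
  vertices and closes no loop. Hence \<open>tilde d\<close> is the sum of \<open>(-1)\<^bsup>|E|\<^esup> (d - E)\<close> over all sets
  \<open>E\<close> of horizontal edges, \<open>bar d\<close> is the same sum over all sets of edges, and \<open>bar d\<close> is the
  alternating sum of \<open>tilde (d - V)\<close> over the sets \<open>V\<close> of vertical edges, where \<open>d - V\<close> is again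
  balanced. Both families are unitriangular with respect to the number of edges. Of planarity, only
  its stability under removal of edges matters.\<close>

section \<open>Removing edges\<close>

lemma finite_vertices [simp]: "finite (vertices k)"
  by (simp add: vertices_def)

lemma edges_remove_edges: "edges (remove_edges d E) = edges d - E"
  by (auto simp: edges_def remove_edges_def)

lemma cups_remove_edges: "cups (remove_edges d E) = cups d - E"
  by (auto simp: cups_def edges_remove_edges)

lemma caps_remove_edges: "caps (remove_edges d E) = caps d - E"
  by (auto simp: caps_def edges_remove_edges)

lemma cups_subset_edges: "cups d \<subseteq> edges d" and caps_subset_edges: "caps d \<subseteq> edges d"
  by (auto simp: cups_def caps_def)

lemma cups_caps_disjoint: "cups d \<inter> caps d = {}"
proof -
  have "card e \<noteq> 2" if "e \<subseteq> range Top" "e \<subseteq> range Bot" for e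
  proof -
    have "e = {}" using that by auto
    then show ?thesis by simp
  qed
  then show ?thesis by (auto simp: cups_def caps_def edges_def)
qed

text \<open>The singletons created by removing \<open>E\<close> survive the removal of
  \<open>F\<close>, because \<open>F\<close> contains only blocks of size two. The sets
  \<open>E\<close> and \<open>F\<close> may overlap.\<close>

lemma remove_edges_remove_edges:
  assumes "F \<subseteq> edges d"
  shows "remove_edges (remove_edges d E) F = remove_edges d (E \<union> F)"
  using assms by (auto simp: remove_edges_def edges_def)

lemma remove_edges_empty [simp]: "remove_edges d {} = d"
  by (simp add: remove_edges_def)

context
  fixes k d assumes d: "d \<in> partial_brauer k"
begin

lemma block_unique: "b \<in> d \<Longrightarrow> c \<in> d \<Longrightarrow> x \<in> b \<Longrightarrow> x \<in> c \<Longrightarrow> b = c"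
  using d unfolding partial_brauer_def partition_on_def disjoint_def by blast

lemma block_nonempty: "b \<in> d \<Longrightarrow> b \<noteq> {}"
  using d by (auto simp: partial_brauer_def partition_on_def)

lemma Union_diagram: "\<Union> d = vertices k"
  using d by (auto simp: partial_brauer_def partition_on_def)

lemma finite_diagram: "finite d"
  by (rule finite_UnionD) (simp add: Union_diagram)

lemma finite_edges: "finite (edges d)"
  using finite_diagram by (auto simp: edges_def)

lemma finite_block: "b \<in> d \<Longrightarrow> finite b"
  using Union_diagram by (metis Union_upper finite_subset finite_vertices)

lemma block_cases:
  assumes "b \<in> d"
  obtains v where "b = {v}" | "b \<in> edges d"
proof -
  have "b \<noteq> {}" "card b \<le> 2"
    using d assms by (auto simp: partial_brauer_def partition_on_def)
  moreover have "card b \<noteq> 0" using finite_block[OF assms] \<open>b \<noteq> {}\<close> by simp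
  ultimately have "card b = 1 \<or> card b = 2" by linarith
  then show ?thesis using that assms by (auto simp: card_1_singleton_iff edges_def)
qed

lemma remove_edges_partial_brauer:
  assumes E: "E \<subseteq> edges d"
  shows "remove_edges d E \<in> partial_brauer k"
proof -
  have Ed: "E \<subseteq> d" using E by (auto simp: edges_def)
  have "\<Union> (remove_edges d E) = vertices k"
  proof -
    have "\<Union> (remove_edges d E) = \<Union> (d - E) \<union> \<Union> E" by (auto simp: remove_edges_def)
    also have "\<dots> = \<Union> d" using Ed by blast
    finally show ?thesis by (simp add: Union_diagram)
  qed
  moreover have "{} \<notin> remove_edges d E"
    using d by (auto simp: remove_edges_def partial_brauer_def partition_on_def)
  moreover have "disjoint (remove_edges d E)"
    using block_unique Ed unfolding remove_edges_def disjoint_def by blast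
  moreover have "\<forall>b\<in>remove_edges d E. card b \<le> 2"
    using d by (auto simp: remove_edges_def partial_brauer_def)
  ultimately show ?thesis by (simp add: partial_brauer_def partition_on_def)
qed

text \<open>Edges are pairwise disjoint and none of their vertices is already a singleton block, so
  each removed edge is traded for two new blocks. This turns the sign in \<open>bar\<close> into a
  power with exponent \<open>card E\<close>.\<close>

lemma card_remove_edges:
  assumes E: "E \<subseteq> edges d"
  shows "card (remove_edges d E) = card d + card E"
proof -
  have Ed: "E \<subseteq> d" using E by (auto simp: edges_def)
  have finE: "finite E" using Ed finite_diagram finite_subset by blast
  have "pairwise disjnt E"
    unfolding pairwise_def disjnt_def using Ed block_unique by blast
  then have "card (\<Union> E) = (\<Sum>e\<in>E. card e)"
    using Ed finite_block by (intro card_Union_disjoint) auto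
  also have "\<dots> = 2 * card E" using E by (simp add: edges_def subset_iff)
  finally have 1: "card ((\<lambda>v. {v}) ` \<Union> E) = 2 * card E"
    by (simp add: card_image)
  have "{v} \<notin> d - E" if "v \<in> \<Union> E" for v
    using that block_unique Ed by blast
  then have "(d - E) \<inter> (\<lambda>v. {v}) ` \<Union> E = {}" by blast
  moreover have "finite (\<Union> E)" using finE finite_block Ed by auto
  ultimately have "card (remove_edges d E) = card (d - E) + 2 * card E"
    unfolding remove_edges_def using finite_diagram 1 by (subst card_Un_disjoint) auto
  moreover have "card (d - E) + card E = card d"
    using Ed finite_diagram by (metis card_Diff_subset card_mono finE le_add_diff_inverse2)
  ultimately show ?thesis by simp
qed

text \<open>The removed set can be read off from the result as the edges of \<open>d\<close> that
  are missing there.\<close>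

lemma remove_edges_eq_iff:
  assumes "E \<subseteq> edges d" "F \<subseteq> edges d"
  shows "remove_edges d E = remove_edges d F \<longleftrightarrow> E = F"
  using assms edges_remove_edges by (metis double_diff subset_refl)

end

text \<open>The arcs drawn for \<open>d\<close> also serve for the remaining edges.\<close>

lemma planar_remove_edges: "planar k d \<Longrightarrow> planar k (remove_edges d E)"
  unfolding planar_def edges_remove_edges by (metis DiffD1)

lemma remove_vertical_edges_balanced:
  assumes d: "d \<in> balanced_motzkin k" and E: "E \<subseteq> edges d - (cups d \<union> caps d)"
  shows "remove_edges d E \<in> balanced_motzkin k"
proof -
  have "cups (remove_edges d E) = cups d" "caps (remove_edges d E) = caps d"
    using E by (auto simp: cups_remove_edges caps_remove_edges)
  moreover have "remove_edges d E \<in> partial_brauer k"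
    using d E by (intro remove_edges_partial_brauer) (auto simp: balanced_motzkin_def motzkin_def)
  ultimately show ?thesis
    using d planar_remove_edges by (auto simp: balanced_motzkin_def motzkin_def)
qed


section \<open>Multiplication by partial identities\<close>

text \<open>This will be the effect on \<open>d\<close> of multiplying by several diagrams
  \<open>p_diagram k j\<close>. An edge with both ends in \<open>A\<close> is removed just once,
  like an edge with one end in \<open>A\<close>.\<close>

definition isolate :: "diagram \<Rightarrow> vertex set \<Rightarrow> diagram" where
  "isolate d A = remove_edges d {e \<in> edges d. e \<inter> A \<noteq> {}}"

lemma isolate_isolate: "isolate (isolate d A) B = isolate d (A \<union> B)"
proof -
  have "isolate (isolate d A) B = remove_edges d
      ({e \<in> edges d. e \<inter> A \<noteq> {}} \<union> {e \<in> edges d - {e \<in> edges d. e \<inter> A \<noteq> {}}. e \<inter> B \<noteq> {}})"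
    unfolding isolate_def edges_remove_edges by (rule remove_edges_remove_edges) auto
  then show ?thesis unfolding isolate_def by (rule trans) (rule arg_cong[where f = "remove_edges d"], auto)
qed

lemma isolate_empty [simp]: "isolate d {} = d"
  by (simp add: isolate_def)

text \<open>The block of \<open>u\<close> in \<open>isolate d A\<close>, in the form in which
  composition produces it. Deleting \<open>A\<close> suffices for \<open>u\<close> outside
  \<open>A\<close>: blocks have at most two elements, so a neighbour in \<open>A\<close> leaves only
  \<open>u\<close>.\<close>

definition isolate_block :: "diagram \<Rightarrow> vertex set \<Rightarrow> vertex \<Rightarrow> vertex set" where
  "isolate_block d A u = (if u \<in> A then {u} else {v. \<exists>b\<in>d. u \<in> b \<and> v \<in> b} - A)"

text \<open>\<open>diagram_comp\<close> yields the image of the vertex set under taking blocks; this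
  brings \<open>isolate\<close> into the same shape, so that the two can be compared vertex by
  vertex.\<close>

lemma isolate_eq_image:
  assumes d: "d \<in> partial_brauer k"
  shows "isolate d A = isolate_block d A ` vertices k"
proof -
  have block: "isolate_block d A u = (if u \<in> A then {u} else b - A)" if "b \<in> d" "u \<in> b" for u b
    using that block_unique[OF d] unfolding isolate_block_def by auto
  have touched: "isolate_block d A u = {u}"
    if e: "e \<in> edges d" "e \<inter> A \<noteq> {}" "u \<in> e" for u e
  proof -
    obtain x y where "e = {x, y}" using e(1) unfolding edges_def card_2_iff by blast
    then show ?thesis using block[of e u] e by (auto simp: edges_def)
  qed
  have untouched: "isolate_block d A u = b"
    if b: "b \<in> d" "\<not> (b \<in> edges d \<and> b \<inter> A \<noteq> {})" "u \<in> b" for u b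
    using block_cases[OF d b(1)]
  proof cases
    case 1
    then show ?thesis using block[OF b(1) b(3)] b(3) by auto
  next
    case 2
    then show ?thesis using block[OF b(1) b(3)] b(2,3) by auto
  qed
  show ?thesis
  proof (intro equalityI subsetI)
    fix b assume "b \<in> isolate d A"
    then consider (keep) "b \<in> d" "\<not> (b \<in> edges d \<and> b \<inter> A \<noteq> {})"
      | (split) e u where "e \<in> edges d" "e \<inter> A \<noteq> {}" "u \<in> e" "b = {u}"
      unfolding isolate_def remove_edges_def by blast
    then show "b \<in> isolate_block d A ` vertices k"
    proof cases
      case keep
      then obtain u where u: "u \<in> b"
        using block_nonempty[OF d keep(1)] by blast
      then have "u \<in> vertices k" using keep(1) Union_diagram[OF d] by blast
      then show ?thesis using untouched[OF keep u] by blast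
    next
      case split
      then have "u \<in> vertices k" using Union_diagram[OF d] by (auto simp: edges_def)
      then show ?thesis using touched[OF split(1-3)] split(4) by blast
    qed
  next
    fix b assume "b \<in> isolate_block d A ` vertices k"
    then obtain u c where u: "b = isolate_block d A u" "c \<in> d" "u \<in> c"
      using Union_diagram[OF d] by blast
    show "b \<in> isolate d A"
    proof (cases "c \<in> edges d \<and> c \<inter> A \<noteq> {}")
      case True
      then show ?thesis using touched[of c u] u by (auto simp: isolate_def remove_edges_def)
    next
      case False
      then show ?thesis using untouched[of c u] u by (auto simp: isolate_def remove_edges_def)
    qed
  qed
qed

text \<open>Here \<open>inn\<close> places \<open>d\<close> in the three-row picture and \<open>S\<close> is the row of \<open>d\<close> that becomes the
  middle row; the other diagram consists of the vertical edges from the vertices of \<open>S - A\<close>. This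
  covers multiplication from the left and from the right.\<close>

lemma connected_iff_isolate_block:
  fixes inn out :: "vertex \<Rightarrow> stack_vertex"
  assumes d: "d \<in> partial_brauer k"
    and "inj inn" "inj out" and out_inn: "\<And>v w. out v = inn w \<Longrightarrow> v = w"
    and out_A: "\<And>v. v \<in> A \<Longrightarrow> out v \<noteq> inn v"
    and out_S: "\<And>v. v \<in> vertices k \<Longrightarrow> v \<notin> S \<Longrightarrow> out v = inn v"
    and R: "R = {(x, y). \<exists>e \<in> (`) inn ` edges d \<union> (\<lambda>v. {out v, inn v}) ` (S - A). x \<in> e \<and> y \<in> e}"
    and u: "u \<in> vertices k" and v: "v \<in> vertices k"
  shows "(out u, out v) \<in> R\<^sup>* \<longleftrightarrow> v \<in> isolate_block d A u"
proof
  define B where "B = {v. \<exists>b\<in>d. u \<in> b \<and> v \<in> b}"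
  \<comment> \<open>The candidate for the component of \<open>out u\<close>. If \<open>u\<close> is
    in \<open>A\<close>, no edge reaches \<open>out u\<close>; otherwise the component holds the
    copies of the block of \<open>u\<close> in the rows of \<open>d\<close> and the outer copies of
    its vertices outside \<open>A\<close>.\<close>
  define G where "G = (if u \<in> A then {out u} else inn ` B \<union> out ` (B - A))"
  have eqD: "v = w" if "out v = inn w \<or> inn w = out v \<or> out v = out w \<or> inn v = inn w" for v w
    using that out_inn \<open>inj inn\<close> \<open>inj out\<close> by (metis injD)
  have uB: "u \<in> B" using u Union_diagram[OF d] by (auto simp: B_def)
  have B_edge: "w' \<in> B" if "w \<in> B" "e \<in> edges d" "w \<in> e" "w' \<in> e" for e w w'
    using that block_unique[OF d, of _ e w] by (auto simp: B_def edges_def)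
  have step: "y \<in> G" if x: "x \<in> G" and xy: "(x, y) \<in> R" for x y
  proof -
    from xy consider (edge) e w w' where "e \<in> edges d" "w \<in> e" "w' \<in> e" "x = inn w" "y = inn w'"
      | (vertical) w where "w \<in> S - A" "x \<in> {out w, inn w}" "y \<in> {out w, inn w}"
      unfolding R by blast
    then show ?thesis
    proof cases
      case edge
      \<comment> \<open>For \<open>u\<close> in \<open>A\<close> the only member of \<open>G\<close>
        is \<open>out u\<close>. Were it equal to \<open>inn w\<close>, then \<open>w = u\<close>,
        against \<open>out_A\<close>.\<close>
      have "u \<notin> A" using x edge(4) eqD out_A unfolding G_def by (metis singletonD)
      then have "w \<in> B" using x edge(4) eqD unfolding G_def by auto
      then show ?thesis using B_edge edge \<open>u \<notin> A\<close> by (auto simp: G_def)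
    next
      case vertical
      have "u \<notin> A" using x vertical(1,2) eqD unfolding G_def by (metis DiffD2 insertE singletonD)
      then have "w \<in> B" using x vertical(2) eqD unfolding G_def by auto
      then show ?thesis using vertical \<open>u \<notin> A\<close> by (auto simp: G_def)
    qed
  qed
  {
    assume "(out u, out v) \<in> R\<^sup>*"
    then have "out v \<in> G"
      by (induction rule: rtrancl_induct) (use step uB in \<open>auto simp: G_def\<close>)
    show "v \<in> isolate_block d A u"
    proof (cases "u \<in> A")
      case True
      then have "v = u" using \<open>out v \<in> G\<close> eqD by (simp add: G_def)
      then show ?thesis using True by (simp add: isolate_block_def)
    next
      case False
      then consider w where "w \<in> B" "out v = inn w" | w where "w \<in> B - A" "out v = out w"
        using \<open>out v \<in> G\<close> by (auto simp: G_def)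
      then have "v \<in> B - A"
      proof cases
        case 1
        \<comment> \<open>The two copies of \<open>v\<close> then coincide, which by
          \<open>out_A\<close> happens only outside \<open>A\<close>.\<close>
        then have "v = w" using eqD by blast
        then show ?thesis using 1 out_A by auto
      next
        case 2
        then have "v = w" using eqD by blast
        then show ?thesis using 2 by simp
      qed
      then show ?thesis using False by (simp add: B_def isolate_block_def)
    qed
  }
  {
    \<comment> \<open>Outside \<open>A\<close> the two copies of a vertex are joined by a vertical
      edge if it lies in \<open>S\<close>, and are equal otherwise.\<close>
    have out_in: "(out w, inn w) \<in> R\<^sup>* \<and> (inn w, out w) \<in> R\<^sup>*" if "w \<in> vertices k" "w \<notin> A" for w
    proof (cases "w \<in> S")
      case True
      then have "(out w, inn w) \<in> R" "(inn w, out w) \<in> R" using that unfolding R by blast+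
      then show ?thesis by blast
    qed (use out_S that in auto)
    assume v_block: "v \<in> isolate_block d A u"
    show "(out u, out v) \<in> R\<^sup>*"
    proof (cases "u \<in> A")
      case True
      then show ?thesis using v_block by (simp add: isolate_block_def)
    next
      case False
      then obtain b where b: "b \<in> d" "u \<in> b" "v \<in> b" "v \<notin> A"
        using v_block by (auto simp: isolate_block_def)
      have "(inn u, inn v) \<in> R\<^sup>*"
        using block_cases[OF d b(1)]
      proof cases
        case 1 with b show ?thesis by simp
      next
        case 2
        then have "(inn u, inn v) \<in> R" using b unfolding R by blast
        then show ?thesis by blast
      qed
      then show ?thesis using out_in[OF u False] out_in[OF v b(4)] by (meson rtrancl_trans)
    qed
  }
qed

section \<open>Partial identities and their composites with diagrams\<close>

lemma inj_above: "inj above" and inj_below: "inj below" and inj_outer: "inj outer"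
  by (rule injI, rename_tac v w, case_tac v; case_tac w; simp)+

lemma outer_eq_above: "outer v = above w \<Longrightarrow> v = w" and outer_eq_below: "outer v = below w \<Longrightarrow> v = w"
  by (cases v; cases w; simp)+

text \<open>For \<open>J\<close> inside \<open>{1..k}\<close> this is the composite of the
  \<open>p_diagram k j\<close> with \<open>j\<close> in \<open>J\<close>. Isolating the top ends is
  enough, since every edge of the identity is vertical.\<close>

definition partial_id :: "nat \<Rightarrow> nat set \<Rightarrow> diagram" where
  "partial_id k J = isolate (id_diagram k) (Top ` J)"

lemma edges_id_diagram: "edges (id_diagram k) = id_diagram k"
  by (auto simp: edges_def id_diagram_def)

lemma edges_partial_id: "edges (partial_id k J) = (\<lambda>i. {Top i, Bot i}) ` ({1..k} - J)"
  by (auto simp: partial_id_def isolate_def edges_remove_edges edges_id_diagram)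
     (auto simp: id_diagram_def)

lemma id_diagram_partial_brauer: "id_diagram k \<in> partial_brauer k"
  by (auto simp: partial_brauer_def partition_on_def disjoint_def id_diagram_def vertices_def card_insert_if)

lemma partial_id_partial_brauer: "partial_id k J \<in> partial_brauer k"
  unfolding partial_id_def isolate_def
  by (rule remove_edges_partial_brauer[OF id_diagram_partial_brauer]) auto

lemma partial_id_empty: "partial_id k {} = id_diagram k"
  by (simp add: partial_id_def)

lemma p_diagram_eq_partial_id: "j \<in> {1..k} \<Longrightarrow> p_diagram k j = partial_id k {j}"
  unfolding partial_id_def isolate_def edges_id_diagram
  by (auto simp: p_diagram_def remove_edges_def id_diagram_def)

lemma comp_partial_id_left:
  assumes d: "d \<in> partial_brauer k" and J: "J \<subseteq> {1..k}"
  shows "diagram_comp k (partial_id k J) d = isolate d (Top ` J)"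
proof -
  \<comment> \<open>The middle row is the top row of \<open>d\<close>; a vertical edge at
    \<open>i\<close> joins \<open>Upper i\<close>, the outer copy of \<open>Top i\<close>, to
    \<open>Middle i\<close>, its copy under \<open>below\<close>.\<close>
  have edges: "(`) above ` edges (partial_id k J) =
      (\<lambda>v. {outer v, below v}) ` (Top ` {1..k} - Top ` J)"
    unfolding edges_partial_id by (force simp: image_image)
  have "(outer u, outer v) \<in> connected_in_stack (partial_id k J) d \<longleftrightarrow> v \<in> isolate_block d (Top ` J) u"
    if "u \<in> vertices k" "v \<in> vertices k" for u v
    unfolding connected_in_stack_def edges Un_commute[of "_ ` (_ - _)"]
    by (rule connected_iff_isolate_block[where inn = below and out = outer and S = "Top ` {1..k}"
          and A = "Top ` J", OF d inj_below inj_outer outer_eq_below _ _ refl that])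
       (auto simp: vertices_def)
  moreover have "isolate_block d (Top ` J) u \<subseteq> vertices k" if "u \<in> vertices k" for u
    using that Union_diagram[OF d] by (auto simp: isolate_block_def)
  ultimately show ?thesis
    unfolding diagram_comp_def isolate_eq_image[OF d] by (intro image_cong) auto
qed

lemma comp_partial_id_right:
  assumes d: "d \<in> partial_brauer k" and J: "J \<subseteq> {1..k}"
  shows "diagram_comp k d (partial_id k J) = isolate d (Bot ` J)"
proof -
  have edges: "(`) below ` edges (partial_id k J) =
      (\<lambda>v. {outer v, above v}) ` (Bot ` {1..k} - Bot ` J)"
    unfolding edges_partial_id by (force simp: image_image)
  have "(outer u, outer v) \<in> connected_in_stack d (partial_id k J) \<longleftrightarrow> v \<in> isolate_block d (Bot ` J) u"
    if "u \<in> vertices k" "v \<in> vertices k" for u v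
    unfolding connected_in_stack_def edges
    by (rule connected_iff_isolate_block[where inn = above and out = outer and S = "Bot ` {1..k}"
          and A = "Bot ` J", OF d inj_above inj_outer outer_eq_above _ _ refl that])
       (auto simp: vertices_def)
  moreover have "isolate_block d (Bot ` J) u \<subseteq> vertices k" if "u \<in> vertices k" for u
    using that Union_diagram[OF d] by (auto simp: isolate_block_def)
  ultimately show ?thesis
    unfolding diagram_comp_def isolate_eq_image[OF d] by (intro image_cong) auto
qed

text \<open>Every edge of a partial identity leaves the middle row, so a component containing such
  an edge reaches the upper row and is no middle loop.\<close>

lemma middle_loops_partial_id_left: "middle_loops k (partial_id k J) d = {}"
proof -
  have "False" if C: "C = connected_in_stack (partial_id k J) d `` {Middle i}"
    and *: "\<forall>v\<in>C. v \<in> range Middle \<and> v \<in> \<Union> ((`) above ` edges (partial_id k J))" for C i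
  proof -
    have "Middle i \<in> C" unfolding C connected_in_stack_def by blast
    then obtain e where e: "e \<in> edges (partial_id k J)" "Middle i \<in> above ` e" using * by blast
    then have "e = {Top i, Bot i}" by (auto simp: edges_partial_id)
    then have "Upper i \<in> above ` e" by force
    then have "(Middle i, Upper i) \<in> connected_in_stack (partial_id k J) d"
      using e unfolding connected_in_stack_def by (intro r_into_rtrancl) blast
    then show False using * unfolding C by blast
  qed
  then show ?thesis unfolding middle_loops_def by (auto elim!: quotientE) metis
qed

lemma middle_loops_partial_id_right: "middle_loops k d (partial_id k J) = {}"
proof -
  have "False" if C: "C = connected_in_stack d (partial_id k J) `` {Middle i}"
    and *: "\<forall>v\<in>C. v \<in> range Middle \<and> v \<in> \<Union> ((`) below ` edges (partial_id k J))" for C i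
  proof -
    have "Middle i \<in> C" unfolding C connected_in_stack_def by blast
    then obtain e where e: "e \<in> edges (partial_id k J)" "Middle i \<in> below ` e" using * by blast
    then have "e = {Top i, Bot i}" by (auto simp: edges_partial_id)
    then have "Lower i \<in> below ` e" by force
    then have "(Middle i, Lower i) \<in> connected_in_stack d (partial_id k J)"
      using e unfolding connected_in_stack_def by (intro r_into_rtrancl) blast
    then show False using * unfolding C by blast
  qed
  then show ?thesis unfolding middle_loops_def by (auto elim!: quotientE) metis
qed


section \<open>Bilinearity of the product\<close>

text \<open>The supports of a sum and of its summands differ. Summing over any finite superset,
  where the extra coefficients are zero, gives the common index sets needed for bilinearity.\<close>

lemma mult_superset:
  assumes "finite S" "finite T" "Poly_Mapping.keys x \<subseteq> S" "Poly_Mapping.keys y \<subseteq> T"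
  shows "mult k \<delta> x y = (\<Sum>d\<^sub>1\<in>S. \<Sum>d\<^sub>2\<in>T.
    scale (Poly_Mapping.lookup x d\<^sub>1 * Poly_Mapping.lookup y d\<^sub>2 * \<delta> ^ card (middle_loops k d\<^sub>1 d\<^sub>2))
      (diag (diagram_comp k d\<^sub>1 d\<^sub>2)))"
  unfolding mult_def using assms
  by (intro sum.mono_neutral_cong_left sum.mono_neutral_left ballI sum.neutral)
     (auto simp: in_keys_iff)

lemma mult_diag_diag:
  "mult k \<delta> (diag d\<^sub>1) (diag d\<^sub>2) =
    scale (\<delta> ^ card (middle_loops k d\<^sub>1 d\<^sub>2)) (diag (diagram_comp k d\<^sub>1 d\<^sub>2))"
  by (subst mult_superset[of "{d\<^sub>1}" "{d\<^sub>2}"]) auto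

lemma mult_add_left: "mult k \<delta> (x + x') y = mult k \<delta> x y + mult k \<delta> x' y"
proof -
  let ?S = "Poly_Mapping.keys x \<union> Poly_Mapping.keys x'" and ?T = "Poly_Mapping.keys y"
  have "Poly_Mapping.keys (x + x') \<subseteq> ?S" by (rule keys_add)
  then show ?thesis
    by (simp add: mult_superset[of ?S ?T] lookup_add distrib_right
        poly_mapping_module.scale_left_distrib sum.distrib)
qed

lemma mult_add_right: "mult k \<delta> x (y + y') = mult k \<delta> x y + mult k \<delta> x y'"
proof -
  let ?S = "Poly_Mapping.keys x" and ?T = "Poly_Mapping.keys y \<union> Poly_Mapping.keys y'"
  have "Poly_Mapping.keys (y + y') \<subseteq> ?T" by (rule keys_add)
  then show ?thesis
    by (simp add: mult_superset[of ?S ?T] lookup_add distrib_right distrib_left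
        poly_mapping_module.scale_left_distrib sum.distrib)
qed

lemma keys_scale: "Poly_Mapping.keys (scale c x) \<subseteq> Poly_Mapping.keys x"
  by (auto simp: in_keys_iff)

lemma mult_scale_left: "mult k \<delta> (scale c x) y = scale c (mult k \<delta> x y)"
  by (simp add: mult_superset[of "Poly_Mapping.keys x" "Poly_Mapping.keys y"] keys_scale
      poly_mapping_module.scale_sum_right mult.assoc)

lemma mult_scale_right: "mult k \<delta> x (scale c y) = scale c (mult k \<delta> x y)"
  by (simp add: mult_superset[of "Poly_Mapping.keys x" "Poly_Mapping.keys y"] keys_scale
      poly_mapping_module.scale_sum_right algebra_simps)

lemma mult_zero_left [simp]: "mult k \<delta> 0 y = 0" and mult_zero_right [simp]: "mult k \<delta> x 0 = 0"
  by (simp_all add: mult_def)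

lemma mult_sum_left: "mult k \<delta> (\<Sum>i\<in>I. f i) y = (\<Sum>i\<in>I. mult k \<delta> (f i) y)"
  by (induction I rule: infinite_finite_induct) (auto simp: mult_add_left)

lemma mult_sum_right: "mult k \<delta> x (\<Sum>i\<in>I. f i) = (\<Sum>i\<in>I. mult k \<delta> x (f i))"
  by (induction I rule: infinite_finite_induct) (auto simp: mult_add_right)

lemma mult_diff_left: "mult k \<delta> (x - x') y = mult k \<delta> x y - mult k \<delta> x' y"
  using mult_add_left[of k \<delta> "x - x'" x' y] by simp

lemma mult_partial_id_left:
  assumes "d \<in> partial_brauer k" "J \<subseteq> {1..k}"
  shows "mult k \<delta> (diag (partial_id k J)) (diag d) = diag (isolate d (Top ` J))"
  by (simp add: mult_diag_diag middle_loops_partial_id_left comp_partial_id_left[OF assms])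

lemma mult_partial_id_right:
  assumes "d \<in> partial_brauer k" "J \<subseteq> {1..k}"
  shows "mult k \<delta> (diag d) (diag (partial_id k J)) = diag (isolate d (Bot ` J))"
  by (simp add: mult_diag_diag middle_loops_partial_id_right comp_partial_id_right[OF assms])


section \<open>Alternating sums\<close>

lemma sum_Pow_insert:
  assumes "finite A" "a \<notin> A"
  shows "sum f (Pow (insert a A)) = sum f (Pow A) + (\<Sum>X\<in>Pow A. f (insert a X))"
proof -
  have "inj_on (insert a) (Pow A)" using assms by (auto simp: inj_on_def)
  moreover have "Pow A \<inter> insert a ` Pow A = {}" using assms by auto
  ultimately show ?thesis
    unfolding Pow_insert using assms by (simp add: sum.union_disjoint sum.reindex)
qed

lemma sum_Pow_Un:
  assumes "finite A" "finite B" "A \<inter> B = {}"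
  shows "sum f (Pow (A \<union> B)) = (\<Sum>X\<in>Pow A. \<Sum>Y\<in>Pow B. f (X \<union> Y))"
  using assms
proof (induction A arbitrary: f rule: finite_induct)
  case (insert a A)
  then show ?case
    by (simp add: sum_Pow_insert)
qed simp

text \<open>The two endpoints of an edge contribute \<open>-1 - 1 + 1 = -1\<close> to the coefficient of its removal.\<close>

lemma sum_Pow_Union_edges:
  fixes f :: "'c set set \<Rightarrow> ('b \<Rightarrow>\<^sub>0 'a::comm_ring_1)"
  assumes "finite M" "\<forall>e\<in>M. card e = 2" "disjoint M"
  shows "(\<Sum>A\<in>Pow (\<Union> M). scale ((- 1) ^ card A) (f {e \<in> M. e \<inter> A \<noteq> {}})) =
    (\<Sum>E\<in>Pow M. scale ((- 1) ^ card E) (f E))"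
  using assms
proof (induction M arbitrary: f rule: finite_induct)
  case (insert e M)
  obtain a b where e: "e = {a, b}" "a \<noteq> b" using insert.prems by (auto simp: card_2_iff)
  have disj: "e \<inter> \<Union> M = {}" using insert.prems insert.hyps by (auto simp: disjoint_def)
  \<comment> \<open>Sets of cardinality 2 are finite, since \<open>card\<close> is 0 on infinite
    sets.\<close>
  have fin: "finite (\<Union> M)" using insert by (metis card.infinite finite_Union insertCI zero_neq_numeral)
  have fin': "finite X" if "X \<subseteq> \<Union> M" for X using that fin finite_subset by blast
  \<comment> \<open>A subset of the enlarged union splits into \<open>Y\<close> inside
    \<open>e\<close> and \<open>X\<close> inside the union of \<open>M\<close>. The set
    \<open>Y\<close> only decides whether \<open>e\<close> is touched, and \<open>touched\<close>
    lists its four possible values.\<close>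
  have "{c \<in> insert e M. c \<inter> (Y \<union> X) \<noteq> {}} =
      (if Y = {} then {} else {e}) \<union> {c \<in> M. c \<inter> X \<noteq> {}}" if "X \<subseteq> \<Union> M" "Y \<subseteq> e" for X Y
    using that disj by auto
  note touched = this[of _ "{}"] this[of _ "{a}"] this[of _ "{b}"] this[of _ "{a, b}"]
  let ?g = "\<lambda>A. scale ((- 1) ^ card A) (f {c \<in> insert e M. c \<inter> A \<noteq> {}})"
  let ?t = "\<lambda>A. {c \<in> M. c \<inter> A \<noteq> {}}"
  have ab: "a \<notin> \<Union> M" "b \<notin> \<Union> M" using disj e by auto
  have "sum ?g (Pow (\<Union> (insert e M))) = (\<Sum>X\<in>Pow (\<Union> M). ?g X + ?g (insert b X)
      + (?g (insert a X) + ?g (insert a (insert b X))))"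
  proof -
    have "sum g (Pow (insert a (insert b (\<Union> M)))) = (\<Sum>X\<in>Pow (\<Union> M). g X + g (insert b X)
        + (g (insert a X) + g (insert a (insert b X))))" for g :: "'c set \<Rightarrow> ('b \<Rightarrow>\<^sub>0 'a)"
      using ab e(2) fin by (simp add: sum_Pow_insert sum.distrib)
    moreover have "\<Union> (insert e M) = insert a (insert b (\<Union> M))" using e by auto
    ultimately show ?thesis by (simp only:)
  qed
  also have "\<dots> = (\<Sum>X\<in>Pow (\<Union> M). scale ((- 1) ^ card X) (f (?t X) - f (insert e (?t X))))"
  proof (rule sum.cong[OF refl])
    fix X assume "X \<in> Pow (\<Union> M)"
    then have X: "X \<subseteq> \<Union> M" by simp
    then have "a \<notin> X" "b \<notin> X" "finite X" using ab fin' by auto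
    then have card: "card (insert b X) = Suc (card X)" "card (insert a X) = Suc (card X)"
      "card (insert a (insert b X)) = Suc (Suc (card X))" using e by auto
    show "?g X + ?g (insert b X) + (?g (insert a X) + ?g (insert a (insert b X))) =
        scale ((- 1) ^ card X) (f (?t X) - f (insert e (?t X)))"
      using touched[OF X] e unfolding card
      by (intro poly_mapping_eqI) (simp add: lookup_add lookup_minus algebra_simps)
  qed
  \<comment> \<open>The induction hypothesis is applied to a difference, which is why
    \<open>f\<close> is kept arbitrary.\<close>
  also have "\<dots> = (\<Sum>E\<in>Pow M. scale ((- 1) ^ card E) (f E - f (insert e E)))"
    using insert.IH[of "\<lambda>E. f E - f (insert e E)"] insert.prems
    by (auto simp: disjoint_def)
  also have "\<dots> = (\<Sum>E\<in>Pow M. scale ((- 1) ^ card E) (f E) +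
      scale ((- 1) ^ card (insert e E)) (f (insert e E)))"
  proof (rule sum.cong[OF refl])
    fix E assume "E \<in> Pow M"
    then have "card (insert e E) = Suc (card E)"
      using insert.hyps by (metis PowD card_insert_disjoint finite_subset in_mono)
    then show "scale ((- 1) ^ card E) (f E - f (insert e E)) =
        scale ((- 1) ^ card E) (f E) + scale ((- 1) ^ card (insert e E)) (f (insert e E))"
      by (intro poly_mapping_eqI) (simp add: lookup_add lookup_minus algebra_simps)
  qed
  also have "\<dots> = (\<Sum>E\<in>Pow (insert e M). scale ((- 1) ^ card E) (f E))"
    using insert.hyps by (simp add: sum_Pow_insert sum.distrib)
  finally show ?case .
qed simp

text \<open>A common form for both families: \<open>M\<close> will be the set of horizontal edges
  for \<open>tilde\<close> and the set of all edges for \<open>bar\<close>.\<close>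

definition alternating :: "vertex set set \<Rightarrow> diagram \<Rightarrow> (diagram \<Rightarrow>\<^sub>0 'a::comm_ring_1)" where
  "alternating M d = (\<Sum>E\<in>Pow M. scale ((- 1) ^ card E) (diag (remove_edges d E)))"

text \<open>Removal in two stages, used to combine cups with caps in \<open>tilde\<close> and
  vertical with horizontal edges in \<open>bar\<close>.\<close>

lemma alternating_Un:
  assumes "finite M" "finite N" "M \<inter> N = {}" "N \<subseteq> edges d"
  shows "alternating (M \<union> N) d =
    (\<Sum>E\<in>Pow M. scale ((- 1) ^ card E) (alternating N (remove_edges d E)))"
  unfolding alternating_def sum_Pow_Un[OF assms(1-3)] poly_mapping_module.scale_sum_right
proof (intro sum.cong refl)
  fix E F assume EF: "E \<in> Pow M" "F \<in> Pow N"
  then have "card (E \<union> F) = card E + card F"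
    using assms by (intro card_Un_disjoint) (auto intro: finite_subset)
  moreover have "remove_edges (remove_edges d E) F = remove_edges d (E \<union> F)"
    using EF assms by (intro remove_edges_remove_edges) auto
  ultimately show "scale ((- 1) ^ card (E \<union> F)) (diag (remove_edges d (E \<union> F))) =
      scale ((- 1) ^ card E) (scale ((- 1) ^ card F) (diag (remove_edges (remove_edges d E) F)))"
    by (simp add: power_add)
qed

text \<open>Here \<open>g\<close> will be \<open>Top\<close> or \<open>Bot\<close>. By
  \<open>disj\<close> the isolated vertices touch only edges in \<open>M\<close>, so the sum over
  vertex sets collapses by \<open>sum_Pow_Union_edges\<close> to one over edge sets.\<close>

lemma sum_isolate_eq_alternating:
  assumes d: "d \<in> partial_brauer k" and M: "M \<subseteq> edges d" and "inj g" "g ` I = \<Union> M"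
    and disj: "g ` I \<inter> \<Union> (edges d - M) = {}"
  shows "(\<Sum>J\<in>Pow I. scale ((- 1) ^ card J) (diag (isolate d (g ` J)))) = alternating M d"
proof -
  have inj: "inj_on ((`) g) (Pow I)"
    using \<open>inj g\<close> by (simp add: inj_on_def inj_image_eq_iff)
  have "(\<Sum>J\<in>Pow I. scale ((- 1) ^ card J) (diag (isolate d (g ` J)))) =
      (\<Sum>J\<in>Pow I. scale ((- 1) ^ card (g ` J)) (diag (isolate d (g ` J))))"
    using \<open>inj g\<close> by (simp add: card_image inj_on_subset)
  also have "\<dots> = (\<Sum>A\<in>Pow (\<Union> M). scale ((- 1) ^ card A) (diag (isolate d A)))"
    unfolding \<open>g ` I = \<Union> M\<close>[symmetric] image_Pow_surj[OF refl, symmetric]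
    by (simp add: sum.reindex[OF inj])
  also have "\<dots> = (\<Sum>A\<in>Pow (\<Union> M). scale ((- 1) ^ card A)
      (diag (remove_edges d {e \<in> M. e \<inter> A \<noteq> {}})))"
  proof (rule sum.cong[OF refl])
    fix A assume A: "A \<in> Pow (\<Union> M)"
    have "e \<in> M" if "e \<in> edges d" "e \<inter> A \<noteq> {}" for e
      using that A disj unfolding \<open>g ` I = \<Union> M\<close> by blast
    then have "{e \<in> edges d. e \<inter> A \<noteq> {}} = {e \<in> M. e \<inter> A \<noteq> {}}" using M by blast
    then show "scale ((- 1) ^ card A) (diag (isolate d A)) =
        scale ((- 1) ^ card A) (diag (remove_edges d {e \<in> M. e \<inter> A \<noteq> {}}))"
      by (simp add: isolate_def)
  qed
  also have "\<dots> = alternating M d"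
    unfolding alternating_def
  proof (rule sum_Pow_Union_edges)
    show "finite M" using M finite_edges[OF d] finite_subset by blast
    show "\<forall>e\<in>M. card e = 2" using M by (auto simp: edges_def)
    show "disjoint M" using M block_unique[OF d] unfolding disjoint_def edges_def by blast
  qed
  finally show ?thesis .
qed

section \<open>Both families as alternating sums\<close>

lemma bar_eq_alternating:
  assumes d: "d \<in> partial_brauer k"
  shows "bar d = alternating (edges d) d"
proof -
  have "below_diagrams d = remove_edges d ` Pow (edges d)"
    by (auto simp: below_diagrams_def)
  \<comment> \<open>Each diagram below \<open>d\<close> comes from exactly one set of edges, so the
    sum can be reindexed.\<close>
  moreover have "inj_on (remove_edges d) (Pow (edges d))"
    by (auto simp: inj_on_def remove_edges_eq_iff[OF d])
  ultimately show ?thesis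
    by (simp add: bar_def alternating_def sum.reindex card_remove_edges[OF d])
qed

lemma prod_one_minus_p_eq:
  assumes "I \<subseteq> {1..k}"
  shows "prod_one_minus_p k \<delta> I = (\<Sum>J\<in>Pow I. scale ((- 1) ^ card J) (diag (partial_id k J)))"
proof -
  have "foldr (\<lambda>i. mult k \<delta> (diag (id_diagram k) - diag (p_diagram k i))) is (diag (id_diagram k)) =
      (\<Sum>J\<in>Pow (set is). scale ((- 1) ^ card J) (diag (partial_id k J)))"
    if "distinct is" "set is \<subseteq> {1..k}" for "is"
    using that
  proof (induction "is")
    case Nil
    then show ?case by (simp add: partial_id_empty)
  next
    case (Cons i "is")
    \<comment> \<open>Multiplying by the factor for \<open>i\<close> keeps each term and adds its
      negative with \<open>i\<close> inserted into \<open>J\<close>, which is the recursion for sums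
      over a power set.\<close>
    have step: "mult k \<delta> (diag (id_diagram k) - diag (p_diagram k i))
        (scale ((- 1) ^ card J) (diag (partial_id k J)) :: diagram \<Rightarrow>\<^sub>0 'a) =
      scale ((- 1) ^ card J) (diag (partial_id k J)) +
      scale ((- 1) ^ card (insert i J)) (diag (partial_id k (insert i J)))"
      if J: "J \<in> Pow (set is)" for J
    proof -
      have "card (insert i J) = Suc (card J)"
        using J Cons.prems by (metis PowD card_insert_disjoint distinct.simps(2) in_mono List.finite_set finite_subset)
      moreover have "mult k \<delta> (diag (id_diagram k)) (diag (partial_id k J)) = diag (partial_id k J)"
        using mult_partial_id_left[OF partial_id_partial_brauer, of "{}" k \<delta> J]
        by (simp add: partial_id_empty)
      moreover have "mult k \<delta> (diag (p_diagram k i)) (diag (partial_id k J)) =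
          diag (partial_id k (insert i J))"
        using mult_partial_id_left[OF partial_id_partial_brauer, of "{i}" k \<delta> J] Cons.prems
        by (simp add: p_diagram_eq_partial_id partial_id_def isolate_isolate)
      ultimately show ?thesis
        by (simp add: mult_scale_right mult_diff_left poly_mapping_module.scale_right_diff_distrib)
    qed
    show ?case
      using Cons by (simp add: mult_sum_right step sum.distrib sum_Pow_insert)
  qed
  moreover have "finite I" using assms finite_subset by blast
  ultimately show ?thesis
    using assms by (simp add: prod_one_minus_p_def)
qed

lemma tilde_eq_alternating:
  fixes \<delta> :: "'a::comm_ring_1"
  assumes d: "d \<in> partial_brauer k"
  shows "tilde k \<delta> d = alternating (cups d \<union> caps d) d"
proof -
  let ?U = "upper_horizontal k d" and ?L = "lower_horizontal k d"
  have disj: "e = e'" if "e \<in> edges d" "e' \<in> edges d" "x \<in> e" "x \<in> e'" for e e' x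
    using that block_unique[OF d] by (auto simp: edges_def)
  have in_vertices: "x \<in> vertices k" if "e \<in> edges d" "x \<in> e" for e x
    using that Union_diagram[OF d] by (auto simp: edges_def)
  have U: "Top ` ?U = \<Union> (cups d)"
    using in_vertices cups_subset_edges[of d]
    by (fastforce simp: upper_horizontal_def cups_def vertices_def)
  have L: "Bot ` ?L = \<Union> (caps d)"
    using in_vertices caps_subset_edges[of d]
    by (fastforce simp: lower_horizontal_def caps_def vertices_def)
  have UL: "?U \<subseteq> {1..k}" "?L \<subseteq> {1..k}"
    by (auto simp: upper_horizontal_def lower_horizontal_def)
  have "mult k \<delta> (prod_one_minus_p k \<delta> ?U) (diag d) =
      (\<Sum>J\<in>Pow ?U. scale ((- 1) ^ card J) (diag (isolate d (Top ` J))))"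
    unfolding prod_one_minus_p_eq[OF UL(1)] mult_sum_left
    using UL by (intro sum.cong refl) (auto simp: mult_scale_left mult_partial_id_left[OF d])
  also have "\<dots> = alternating (cups d) d"
  proof (rule sum_isolate_eq_alternating[OF d cups_subset_edges])
    show "Top ` ?U \<inter> \<Union> (edges d - cups d) = {}"
      using disj cups_subset_edges[of d] unfolding U by blast
  qed (use U in \<open>auto simp: inj_def\<close>)
  finally have left: "mult k \<delta> (prod_one_minus_p k \<delta> ?U) (diag d) = alternating (cups d) d" .
  \<comment> \<open>Removing cups leaves the caps unchanged, so \<open>?L\<close>, computed from
    \<open>d\<close>, is also the right index set for each diagram produced by the left
    factor.\<close>
  have right: "mult k \<delta> (diag (remove_edges d E)) (prod_one_minus_p k \<delta> ?L) =
      (alternating (caps d) (remove_edges d E) :: diagram \<Rightarrow>\<^sub>0 'a)" if E: "E \<subseteq> cups d" for E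
  proof -
    have dE: "remove_edges d E \<in> partial_brauer k"
      using E cups_subset_edges by (intro remove_edges_partial_brauer[OF d]) blast
    have "mult k \<delta> (diag (remove_edges d E)) (prod_one_minus_p k \<delta> ?L) =
        (\<Sum>J\<in>Pow ?L. scale ((- 1) ^ card J) (diag (isolate (remove_edges d E) (Bot ` J))))"
      unfolding prod_one_minus_p_eq[OF UL(2)] mult_sum_right
      using UL by (intro sum.cong refl) (auto simp: mult_scale_right mult_partial_id_right[OF dE])
    also have "\<dots> = alternating (caps d) (remove_edges d E)"
    proof (rule sum_isolate_eq_alternating[OF dE])
      show "caps d \<subseteq> edges (remove_edges d E)"
        using E cups_caps_disjoint[of d] caps_subset_edges[of d] by (auto simp: edges_remove_edges)
      show "Bot ` ?L \<inter> \<Union> (edges (remove_edges d E) - caps d) = {}"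
        using disj caps_subset_edges[of d] unfolding L edges_remove_edges by blast
    qed (use L in \<open>auto simp: inj_def\<close>)
    finally show ?thesis .
  qed
  have "tilde k \<delta> d = mult k \<delta> (alternating (cups d) d) (prod_one_minus_p k \<delta> ?L)"
    by (simp add: tilde_def left)
  also have "\<dots> = (\<Sum>E\<in>Pow (cups d). scale ((- 1) ^ card E) (alternating (caps d) (remove_edges d E)))"
    by (simp add: alternating_def[of "cups d"] mult_sum_left mult_scale_left right)
  also have "\<dots> = alternating (cups d \<union> caps d) d"
    using finite_edges[OF d] cups_subset_edges[of d] caps_subset_edges[of d] cups_caps_disjoint[of d]
    by (intro alternating_Un[symmetric]) (auto intro: finite_subset)
  finally show ?thesis .
qed


section \<open>The two bases\<close>

lemma unitriangular_independent:
  fixes v :: "'b \<Rightarrow> ('b \<Rightarrow>\<^sub>0 'a::comm_ring_1)" and m :: "'b \<Rightarrow> nat"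
  assumes one: "\<And>d. d \<in> I \<Longrightarrow> Poly_Mapping.lookup (v d) d = 1"
    and less: "\<And>d d'. d \<in> I \<Longrightarrow> d' \<noteq> d \<Longrightarrow> Poly_Mapping.lookup (v d) d' \<noteq> 0 \<Longrightarrow> m d' < m d"
  shows "inj_on v I \<and> \<not> module.dependent scale (v ` I)"
proof
  show inj: "inj_on v I"
  proof (rule inj_onI, rule ccontr)
    fix d d' assume *: "d \<in> I" "d' \<in> I" "v d = v d'" "d \<noteq> d'"
    \<comment> \<open>Since \<open>v d = v d'\<close>, each vector has coefficient 1 at the other
      index, so \<open>less\<close> applies in both directions.\<close>
    then have "m d < m d'" "m d' < m d"
      using one[of d] one[of d'] less[of d d'] less[of d' d] by auto
    then show False by simp
  qed
  show "\<not> module.dependent scale (v ` I)"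
  proof
    assume "module.dependent scale (v ` I)"
    then obtain t u where t: "finite t" "t \<subseteq> v ` I" "(\<Sum>x\<in>t. scale (u x) x) = 0" "\<exists>x\<in>t. u x \<noteq> 0"
      unfolding poly_mapping_module.dependent_explicit by blast
    obtain D where D: "D \<subseteq> I" "finite D" "t = v ` D"
      using t(1,2) by (meson finite_subset_image)
    define N where "N = {d \<in> D. u (v d) \<noteq> 0}"
    have "finite N" "N \<noteq> {}" using D t(4) by (auto simp: N_def)
    then obtain d where d: "d \<in> N" "\<forall>d'\<in>N. m d' \<le> m d"
      using Max_in[of "m ` N"] Max_ge[of "m ` N"] by (metis (no_types, lifting) finite_imageI image_iff image_is_empty)
    have dD: "d \<in> D" using d(1) by (simp add: N_def)
    \<comment> \<open>A nonzero product would give \<open>d'\<close> in \<open>N\<close> with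
      \<open>m d < m d'\<close>, against the choice of \<open>d\<close>.\<close>
    have zero: "u (v d') * Poly_Mapping.lookup (v d') d = 0" if "d' \<in> D - {d}" for d'
    proof (rule ccontr)
      assume "\<not> ?thesis"
      then have "d' \<in> N" "Poly_Mapping.lookup (v d') d \<noteq> 0" using that by (auto simp: N_def)
      then show False using less[of d' d] that D(1) d(2) by fastforce
    qed
    have "0 = Poly_Mapping.lookup (\<Sum>d'\<in>D. scale (u (v d')) (v d')) d"
      using t(3) D inj by (simp add: sum.reindex inj_on_subset)
    also have "\<dots> = (\<Sum>d'\<in>D. u (v d') * Poly_Mapping.lookup (v d') d)"
      by (simp add: lookup_sum)
    also have "\<dots> = u (v d)"
      using D dD zero one[of d] by (subst sum.remove[of D d]) auto
    finally show False using d(1) by (simp add: N_def)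
  qed
qed

lemma alternating_independent:
  assumes I: "I \<subseteq> partial_brauer k" and M: "\<And>d. d \<in> I \<Longrightarrow> M d \<subseteq> edges d"
    and v: "\<And>d. d \<in> I \<Longrightarrow> v d = (alternating (M d) d :: diagram \<Rightarrow>\<^sub>0 'a::comm_ring_1)"
  shows "inj_on v I \<and> \<not> module.dependent scale (v ` I)"
proof (rule unitriangular_independent[where m = "\<lambda>d. card (edges d)"])
  fix d assume dI: "d \<in> I"
  then have d: "d \<in> partial_brauer k" using I by blast
  have fin: "finite (edges d)" "finite (M d)"
    using finite_edges[OF d] M[OF dI] finite_subset by blast+
  have lookup: "Poly_Mapping.lookup (v d) d' =
      (\<Sum>E\<in>Pow (M d). (- 1) ^ card E * (1 when remove_edges d E = d'))" for d'
    by (simp add: v[OF dI] alternating_def lookup_sum lookup_single)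
  \<comment> \<open>Only the empty set of removed edges contributes to the coefficient at
    \<open>d\<close>.\<close>
  have neq: "remove_edges d E \<noteq> d" if "E \<subseteq> M d" "E \<noteq> {}" for E
    using remove_edges_eq_iff[OF d, of E "{}"] that M[OF dI] by auto
  have "Poly_Mapping.lookup (v d) d = (\<Sum>E\<in>{{}}. (- 1) ^ card E * (1 when remove_edges d E = d))"
    unfolding lookup using fin neq by (intro sum.mono_neutral_right) auto
  then show "Poly_Mapping.lookup (v d) d = 1" by simp
  fix d' assume "d' \<noteq> d" "Poly_Mapping.lookup (v d) d' \<noteq> 0"
  then obtain E where "E \<in> Pow (M d)" "(- 1) ^ card E * (1 when remove_edges d E = d') \<noteq> (0 :: 'a)"
    unfolding lookup by (meson sum.not_neutral_contains_not_neutral)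
  then have E: "E \<subseteq> M d" "remove_edges d E = d'" by (auto simp: when_def split: if_splits)
  then have "E \<noteq> {}" using \<open>d' \<noteq> d\<close> by auto
  then have "edges d' \<subset> edges d" using E M[OF dI] unfolding E(2)[symmetric] edges_remove_edges by blast
  then show "card (edges d') < card (edges d)" using fin psubset_card_mono by blast
qed

text \<open>Removing vertical edges first leaves the cups and caps intact, so the inner alternating
  sum over horizontal edges is again a \<open>tilde\<close>. This holds for every
  \<open>\<delta>\<close>, although \<open>bar\<close> does not involve it.\<close>

lemma bar_eq_sum_tilde:
  fixes \<delta> :: "'a::comm_ring_1"
  assumes d: "d \<in> partial_brauer k"
  shows "bar d = (\<Sum>E\<in>Pow (edges d - (cups d \<union> caps d)).
    scale ((- 1) ^ card E) (tilde k \<delta> (remove_edges d E)))"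
proof -
  let ?V = "edges d - (cups d \<union> caps d)" and ?H = "cups d \<union> caps d"
  have "bar d = (alternating (?V \<union> ?H) d :: diagram \<Rightarrow>\<^sub>0 'a)"
    unfolding bar_eq_alternating[OF d] using cups_subset_edges[of d] caps_subset_edges[of d]
    by (intro arg_cong[where f = "\<lambda>M. alternating M d"]) auto
  also have "\<dots> = (\<Sum>E\<in>Pow ?V. scale ((- 1) ^ card E) (alternating ?H (remove_edges d E)))"
    using finite_edges[OF d] cups_subset_edges[of d] caps_subset_edges[of d]
    by (intro alternating_Un) (auto intro: finite_subset)
  also have "\<dots> = (\<Sum>E\<in>Pow ?V. scale ((- 1) ^ card E) (tilde k \<delta> (remove_edges d E)))"
  proof (rule sum.cong[OF refl])
    fix E assume E: "E \<in> Pow ?V"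
    then have "remove_edges d E \<in> partial_brauer k"
      by (intro remove_edges_partial_brauer[OF d]) auto
    moreover have "cups (remove_edges d E) \<union> caps (remove_edges d E) = ?H"
      using E by (auto simp: cups_remove_edges caps_remove_edges)
    ultimately show "scale ((- 1) ^ card E) (alternating ?H (remove_edges d E)) =
        scale ((- 1) ^ card E) (tilde k \<delta> (remove_edges d E))"
      by (simp add: tilde_eq_alternating)
  qed
  finally show ?thesis .
qed

lemma span_bar_eq_PTL:
  fixes \<delta> :: "'a::comm_ring_1"
  shows "module.span scale (bar ` balanced_motzkin k) = PTL k \<delta>"
proof -
  let ?D = "balanced_motzkin k" and ?V = "\<lambda>d. edges d - (cups d \<union> caps d)"
  have pb: "d \<in> partial_brauer k" if "d \<in> ?D" for d
    using that by (simp add: balanced_motzkin_def motzkin_def)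
  have "bar d \<in> module.span scale (tilde k \<delta> ` ?D)" if d: "d \<in> ?D" for d
    unfolding bar_eq_sum_tilde[OF pb[OF d], of \<delta>]
    using remove_vertical_edges_balanced[OF d]
    by (intro poly_mapping_module.span_sum poly_mapping_module.span_scale
        poly_mapping_module.span_base) auto
  moreover have "tilde k \<delta> d \<in> module.span scale (bar ` ?D)" if "d \<in> ?D" for d
    using that
  \<comment> \<open>The triangular relation is inverted: the term with no edge removed is
    \<open>tilde k \<delta> d\<close>, and all other terms involve balanced diagrams with fewer
    edges.\<close>
  proof (induction "card (edges d)" arbitrary: d rule: less_induct)
    case less
    note d = pb[OF less.prems]
    have fin: "finite (?V d)" using finite_edges[OF d] by simp
    let ?rest = "\<Sum>E\<in>Pow (?V d) - {{}}. scale ((- 1) ^ card E) (tilde k \<delta> (remove_edges d E))"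
    have "bar d = tilde k \<delta> d + ?rest"
      unfolding bar_eq_sum_tilde[OF d, of \<delta>] using fin
      by (subst sum.remove[of _ "{}"]) auto
    then have "tilde k \<delta> d = bar d - ?rest" by simp
    moreover have "?rest \<in> module.span scale (bar ` ?D)"
    proof (intro poly_mapping_module.span_sum poly_mapping_module.span_scale)
      fix E assume E: "E \<in> Pow (?V d) - {{}}"
      then have "edges (remove_edges d E) \<subset> edges d" unfolding edges_remove_edges by blast
      then have "card (edges (remove_edges d E)) < card (edges d)"
        using finite_edges[OF d] psubset_card_mono by blast
      then show "tilde k \<delta> (remove_edges d E) \<in> module.span scale (bar ` ?D)"
        using less E remove_vertical_edges_balanced by blast
    qed
    ultimately show ?case
      using less.prems
      by (simp add: poly_mapping_module.span_diff poly_mapping_module.span_base)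
  qed
  ultimately show ?thesis
    unfolding PTL_def by (subst poly_mapping_module.span_eq) auto
qed

theorem theorem3p1:
  fixes k :: nat and \<delta> :: "'a::comm_ring_1"
  shows "is_basis (tilde k \<delta>) (balanced_motzkin k) (PTL k \<delta>)
    \<and> is_basis bar (balanced_motzkin k) (PTL k \<delta>)"
proof -
  have pb: "balanced_motzkin k \<subseteq> partial_brauer k"
    by (auto simp: balanced_motzkin_def motzkin_def)
  have "inj_on (tilde k \<delta>) (balanced_motzkin k) \<and>
      \<not> module.dependent scale (tilde k \<delta> ` balanced_motzkin k)"
    by (rule alternating_independent[OF pb, where M = "\<lambda>d. cups d \<union> caps d"])
       (use pb tilde_eq_alternating cups_subset_edges caps_subset_edges in blast)+
  moreover have "inj_on (bar :: _ \<Rightarrow> diagram \<Rightarrow>\<^sub>0 'a) (balanced_motzkin k) \<and>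
      \<not> module.dependent scale ((bar :: _ \<Rightarrow> diagram \<Rightarrow>\<^sub>0 'a) ` balanced_motzkin k)"
    by (rule alternating_independent[OF pb, where M = edges]) (use pb bar_eq_alternating in blast)+
  ultimately show ?thesis
    using span_bar_eq_PTL[of k \<delta>] by (simp add: is_basis_def PTL_def)
qed

end
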